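(* Let $w=(w_1,w_2)\in\mathbb{N}_+^2$, and put $\widetilde{w}:=\max\{w_1,w_2\}$ and $\underline{w}:=\min\{w_1,w_2\}$. Then the set $$\left\{ (\deg_w F_1,\deg_w F_2) : F=(F_1,F_2)\in\operatorname{Aut}(\mathbb{C}^2)\right\}$$ of weighted bidegrees of all polynomial automorphisms of $\mathbb{C}^2$ is equal to $A_1\cup A_2\cup\{(w_1,w_2),(w_2,w_1),(\widetilde{w},\widetilde{w})\}$, where for $j=1,2$ the set $A_j$ consists of all pairs $(d_1,d_2)\in (w_j\mathbb{N}_+)^2$ satisfying all three of the following conditions: (i) $d_1\mid d_2$ or $d_2\mid d_1$; (ii) $\max\{d_1,d_2\}\geq \widetilde{w}$; (iii) if $\min\{d_1,d_2\}<\widetilde{w}$, then $\min\{d_1,d_2\}=\underline{w}$.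
   Context: $\mathbb{N}=\{0,1,2,\ldots\}$ and $\mathbb{N}_+=\mathbb{N}\setminus\{0\}$; $w_j\mathbb{N}_+=\{w_jk : k\in\mathbb{N}_+\}$. For $w=(w_1,w_2)\in\mathbb{N}_+^2$ and a nonzero polynomial $h=\sum_{\alpha\in\mathbb{N}^2} c_\alpha x^{\alpha_1}y^{\alpha_2}\in\mathbb{C}[x,y]$, the weighted degree is $\deg_w h=\max\{\alpha_1w_1+\alpha_2w_2 : c_\alpha\neq 0\}$. $\operatorname{Aut}(\mathbb{C}^2)$ is the group of all polynomial automorphisms of $\mathbb{C}^2$, i.e. polynomial maps $F=(F_1,F_2):\mathbb{C}^2\to\mathbb{C}^2$ having a polynomial inverse. *)

theory Defs
  imports Complex_Main "HOL-Computational_Algebra.Polynomial"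
begin

text \<open>
  The ring \<open>\<complex>[x,y]\<close> is represented as \<open>\<complex>[x][y]\<close>: the inner indeterminate is \<open>x\<close>, the outer
  one is \<open>y\<close>.
\<close>
type_synonym bipoly = "complex poly poly"

text \<open>The coefficient of \<open>x\<^sup>i y\<^sup>j\<close>.\<close>
definition coeff2 :: "bipoly \<Rightarrow> nat \<Rightarrow> nat \<Rightarrow> complex" where
  "coeff2 h i j = coeff (coeff h j) i"

definition eval2 :: "bipoly \<Rightarrow> complex \<times> complex \<Rightarrow> complex" where
  "eval2 h = (\<lambda>(a, b). poly (poly h [:b:]) a)"

lemma eval2_altdef:
  "eval2 h (a, b) = (\<Sum>j\<le>degree h. \<Sum>i\<le>degree (coeff h j). coeff2 h i j * a ^ i * b ^ j)"
  by (simp add: eval2_def coeff2_def poly_altdef[of h] poly_sum poly_power poly_altdef[of "coeff h _"]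
      sum_distrib_right)

definition poly_map :: "bipoly \<times> bipoly \<Rightarrow> complex \<times> complex \<Rightarrow> complex \<times> complex" where
  "poly_map F p = (eval2 (fst F) p, eval2 (snd F) p)"

text \<open>A polynomial map is given by its pair of components, which it determines uniquely.\<close>
lemma eval2_inject: "eval2 g = eval2 h \<longleftrightarrow> g = h"
proof
  assume eq: "eval2 g = eval2 h"
  have "poly g [:b:] = poly h [:b:]" for b
  proof -
    have "poly (poly g [:b:]) a = poly (poly h [:b:]) a" for a
      using fun_cong[OF eq, of "(a, b)"] by (simp add: eval2_def)
    then show ?thesis
      by (simp add: poly_eq_poly_eq_iff[symmetric] fun_eq_iff)
  qed
  then have "range (\<lambda>b. [:b:]) \<subseteq> {q. poly (g - h) q = 0}"
    by auto
  moreover have "infinite (range (\<lambda>b::complex. [:b:]))"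
    using finite_imageD[of "\<lambda>b::complex. [:b:]" UNIV] infinite_UNIV_char_0 by (auto simp: inj_on_def)
  ultimately have "infinite {q. poly (g - h) q = 0}"
    using finite_subset by blast
  then show "g = h"
    using poly_roots_finite[of "g - h"] by auto
qed simp

lemma poly_map_inject: "poly_map F = poly_map G \<longleftrightarrow> F = G"
proof
  assume eq: "poly_map F = poly_map G"
  have "eval2 (fst F) = eval2 (fst G)" "eval2 (snd F) = eval2 (snd G)"
    using fun_cong[OF eq] by (auto simp: poly_map_def fun_eq_iff)
  then show "F = G"
    by (simp add: eval2_inject prod_eq_iff)
qed simp

definition Aut_C2 :: "(bipoly \<times> bipoly) set" where
  "Aut_C2 = {F. \<exists>G. poly_map G \<circ> poly_map F = id \<and> poly_map F \<circ> poly_map G = id}"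

text \<open>Only meaningful for \<open>h \<noteq> 0\<close>, since \<open>Max {}\<close> is unspecified.\<close>
definition wdeg :: "nat \<times> nat \<Rightarrow> bipoly \<Rightarrow> nat" where
  "wdeg w h = Max {i * fst w + j * snd w | i j. coeff2 h i j \<noteq> 0}"

lemma finite_wdeg_set: "finite {i * fst w + j * snd w | i j. coeff2 h i j \<noteq> 0}"
proof (rule finite_subset)
  show "{i * fst w + j * snd w | i j. coeff2 h i j \<noteq> 0}
    \<subseteq> (\<lambda>(j, i). i * fst w + j * snd w) ` (SIGMA j:{..degree h}. {..degree (coeff h j)})"
  proof safe
    fix i j assume nz: "coeff2 h i j \<noteq> 0"
    then have "i \<le> degree (coeff h j)"
      by (simp add: coeff2_def le_degree)
    moreover have "j \<le> degree h"
      using nz by (intro le_degree) (auto simp: coeff2_def)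
    ultimately show "i * fst w + j * snd w
      \<in> (\<lambda>(j, i). i * fst w + j * snd w) ` (SIGMA j:{..degree h}. {..degree (coeff h j)})"
      by force
  qed
qed simp

lemma coeff2_nonzero_ex: "h \<noteq> 0 \<Longrightarrow> \<exists>i j. coeff2 h i j \<noteq> 0"
  by (auto simp: coeff2_def poly_eq_iff)

lemma Aut_C2_nonzero:
  assumes "(F1, F2) \<in> Aut_C2"
  shows "F1 \<noteq> 0" "F2 \<noteq> 0"
proof -
  from assms obtain G where "poly_map (F1, F2) \<circ> poly_map G = id"
    by (auto simp: Aut_C2_def)
  then have "poly_map (F1, F2) (poly_map G (1, 1)) = (1, 1)"
    by (metis comp_apply id_apply)
  then show "F1 \<noteq> 0" "F2 \<noteq> 0"
    by (auto simp: poly_map_def eval2_def split: prod.splits)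
qed

text \<open>The set \<open>A\<^sub>j\<close> for the weight \<open>w\<close> is \<open>A_set w v\<close>, where \<open>v\<close> is the \<open>j\<close>-th component of \<open>w\<close>.\<close>
definition A_set :: "nat \<times> nat \<Rightarrow> nat \<Rightarrow> (nat \<times> nat) set" where
  "A_set w v = {(d1, d2).
     d1 \<in> {v * k | k. k > 0} \<and> d2 \<in> {v * k | k. k > 0} \<and>
     (d1 dvd d2 \<or> d2 dvd d1) \<and>
     max d1 d2 \<ge> max (fst w) (snd w) \<and>
     (min d1 d2 < max (fst w) (snd w) \<longrightarrow> min d1 d2 = min (fst w) (snd w))}"

end

theory Submission imports Defs begin

text \<open>
  Let \<open>(f, g)\<close> be an automorphism with weighted degrees \<open>m\<close> and \<open>n\<close>, and let \<open>x = P(f, g)\<close>,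
  \<open>y = Q(f, g)\<close> describe its inverse. The degrees are governed by how much cancellation occurs
  among the top terms of \<open>P(f, g)\<close> and \<open>Q(f, g)\<close>.

  If the leading forms of \<open>f\<close> and \<open>g\<close> cause no cancellation in \<open>P\<close> and \<open>Q\<close>, then the
  \<open>(m, n)\<close>-degrees of \<open>P\<close> and \<open>Q\<close> are at most \<open>w1\<close> and \<open>w2\<close>. Elementary lower bounds, applied to
  the automorphism and to its inverse, then force \<open>{m, n} = {w1, w2}\<close> (\<open>wdeg_eq_weights\<close>).

  Cancellation is bounded by the Jacobian, which is a nonzero constant. The derivation
  \<open>h \<mapsto> jacobian f h\<close> acts on polynomials in \<open>f\<close> and \<open>g\<close> as \<open>\<partial>/\<partial>g\<close> up to that constant and
  raises degrees by at most \<open>m - w1 - w2\<close>. If \<open>k\<close> derivatives are needed to undo the vanishing of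
  the top form of \<open>P\<close> at the leading forms and \<open>P\<close> has \<open>(m, n)\<close>-degree \<open>W\<close>, then
  \<open>k lcm(m, n) \<le> W\<close> and \<open>P(f, g)\<close> has degree at least \<open>W - k (m + n - w1 - w2)\<close>
  (\<open>wdeg_subst_lower_bound\<close>). When neither of
  \<open>m\<close>, \<open>n\<close> divides the other, \<open>lcm(m, n) \<ge> m + n\<close>, and \<open>k > 0\<close> would give a degree of at least
  \<open>w1 + w2\<close>, too large for \<open>x\<close> or \<open>y\<close>. Hence one degree divides the other, or
  \<open>{m, n} = {w1, w2}\<close> (\<open>wdeg_dvd_or_weights\<close>).

  Suppose \<open>n = r m\<close>. A relation between the leading forms confines the quotient of that of
  \<open>g\<close> by the \<open>r\<close>-th power of that of \<open>f\<close> to finitely many values, so it is a constant \<open>c\<close>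
  (\<open>wpart_relation_imp_power\<close>) and \<open>g\<close> can be replaced by
  \<open>g - c f\<^sup>r\<close>, which has smaller degree; with no relation there is no cancellation. By induction,
  each of \<open>m\<close>, \<open>n\<close> is a multiple of \<open>w1\<close> or of \<open>w2\<close> (\<open>wdeg_multiple_of_weight\<close>). Finally,
  a component whose degree is below the larger weight misses one variable and is therefore of degree one
  in the other (\<open>wdeg_small_component\<close>). This gives all the conditions.

  Conversely, the automorphisms \<open>(x, y + x\<^sup>b)\<close> and \<open>(y + x\<^sup>a, x + (y + x\<^sup>a)\<^sup>r)\<close>, together with the
  identity and with exchanges of variables and of components, attain every bidegree in the list
  (\<open>A_set_attained\<close>).
\<close>

section \<open>Substitution into bivariate polynomials\<close>

text \<open>
  Substitution into bivariate polynomials is needed with values in three rings: in \<open>\<complex>\<close> for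
  evaluation, in \<open>\<complex>[x,y]\<close> for composition, and in \<open>\<complex>[x,y][t]\<close> for the weighted grading. The
  facts that all three share are those of a ring homomorphism.
\<close>
locale ring_map =
  fixes \<phi> :: "'a::comm_ring_1 \<Rightarrow> 'b::comm_ring_1"
  assumes add: "\<phi> (a + b) = \<phi> a + \<phi> b"
    and mult: "\<phi> (a * b) = \<phi> a * \<phi> b"
    and one: "\<phi> 1 = 1"
begin

lemma zero: "\<phi> 0 = 0"
  using add[of 0 0] by simp

lemma diff: "\<phi> (a - b) = \<phi> a - \<phi> b"
  using add[of "a - b" b] by simp

lemma sum: "\<phi> (\<Sum>x\<in>A. h x) = (\<Sum>x\<in>A. \<phi> (h x))"
  by (induction A rule: infinite_finite_induct) (simp_all add: zero add)

lemma power: "\<phi> (a ^ n) = \<phi> a ^ n"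
  by (induction n) (simp_all add: one mult)

lemma map_poly_add: "map_poly \<phi> (p + q) = map_poly \<phi> p + map_poly \<phi> q"
  by (simp add: poly_eq_iff coeff_map_poly zero add)

lemma map_poly_mult: "map_poly \<phi> (p * q) = map_poly \<phi> p * map_poly \<phi> q"
  by (simp add: poly_eq_iff coeff_map_poly zero coeff_mult sum mult)

lemma map_poly_one: "map_poly \<phi> 1 = 1"
  by (simp add: poly_eq_iff coeff_map_poly zero one)

end

lemma ring_map_poly:
  assumes "ring_map \<iota>"
  shows "ring_map (\<lambda>p. poly (map_poly \<iota> p) u)"
proof -
  interpret ring_map \<iota> by fact
  show ?thesis
    by unfold_locales (simp_all add: map_poly_add map_poly_mult map_poly_one)
qed

definition subst :: "(complex \<Rightarrow> 'a::comm_ring_1) \<Rightarrow> 'a \<Rightarrow> 'a \<Rightarrow> bipoly \<Rightarrow> 'a" where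
  "subst \<iota> u v P = poly (map_poly (\<lambda>p. poly (map_poly \<iota> p) u) P) v"

lemma ring_map_subst: "ring_map \<iota> \<Longrightarrow> ring_map (subst \<iota> u v)"
  unfolding subst_def by (intro ring_map_poly)

definition supp2 :: "bipoly \<Rightarrow> (nat \<times> nat) set" where
  "supp2 P = {(i, j). coeff2 P i j \<noteq> 0}"

lemma finite_supp2: "finite (supp2 P)"
proof (rule finite_subset)
  show "supp2 P \<subseteq> (\<lambda>(j, i). (i, j)) ` (SIGMA j:{..degree P}. {..degree (coeff P j)})"
  proof safe
    fix i j assume "(i, j) \<in> supp2 P"
    then have nz: "coeff (coeff P j) i \<noteq> 0" by (simp add: supp2_def coeff2_def)
    then have "i \<le> degree (coeff P j)" by (rule le_degree)
    moreover have "j \<le> degree P" using nz by (intro le_degree) auto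
    ultimately show "(i, j) \<in> (\<lambda>(j, i). (i, j)) ` (SIGMA j:{..degree P}. {..degree (coeff P j)})"
      by force
  qed
qed simp

text \<open>
  The expansion into monomials gives both the compatibility of substitution with ring
  homomorphisms and the comparison of degrees in \<open>subst_top\<close>.
\<close>
lemma subst_sum:
  assumes "ring_map \<iota>"
  shows "subst \<iota> u v P = (\<Sum>(i, j)\<in>supp2 P. \<iota> (coeff2 P i j) * u ^ i * v ^ j)"
proof -
  interpret \<iota>: ring_map \<iota> by fact
  interpret s: ring_map "\<lambda>p. poly (map_poly \<iota> p) u" by (rule ring_map_poly) fact
  let ?S = "SIGMA j:{..degree P}. {..degree (coeff P j)}"
  have inner: "poly (map_poly \<iota> p) u = (\<Sum>i\<le>degree p. \<iota> (coeff p i) * u ^ i)" for p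
    using poly_altdef[of "map_poly \<iota> p" u] map_poly_degree_leq[of \<iota> p]
    by (subst poly_altdef, intro sum.mono_neutral_cong_left)
       (auto simp: coeff_map_poly \<iota>.zero intro!: le_degree)
  have "subst \<iota> u v P = (\<Sum>j\<le>degree P. poly (map_poly \<iota> (coeff P j)) u * v ^ j)"
    unfolding subst_def using map_poly_degree_leq[of "\<lambda>p. poly (map_poly \<iota> p) u" P]
    by (subst poly_altdef, intro sum.mono_neutral_cong_left)
       (auto simp: coeff_map_poly intro!: le_degree)
  also have "\<dots> = (\<Sum>(j, i)\<in>?S. \<iota> (coeff2 P i j) * u ^ i * v ^ j)"
    by (simp add: inner sum_distrib_right sum.Sigma coeff2_def)
  also have "\<dots> = (\<Sum>(j, i)\<in>prod.swap ` supp2 P. \<iota> (coeff2 P i j) * u ^ i * v ^ j)"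
  proof (intro sum.mono_neutral_right)
    show "prod.swap ` supp2 P \<subseteq> ?S"
      by (auto simp: supp2_def coeff2_def intro!: le_degree)
    show "\<forall>k\<in>?S - prod.swap ` supp2 P. (case k of (j, i) \<Rightarrow> \<iota> (coeff2 P i j) * u ^ i * v ^ j) = 0"
      by (auto simp: supp2_def \<iota>.zero image_iff)
  qed auto
  also have "\<dots> = (\<Sum>(i, j)\<in>supp2 P. \<iota> (coeff2 P i j) * u ^ i * v ^ j)"
    by (subst sum.reindex) (auto simp: case_prod_unfold)
  finally show ?thesis .
qed

lemma ring_map_comp: "ring_map \<phi> \<Longrightarrow> ring_map \<psi> \<Longrightarrow> ring_map (\<lambda>x. \<phi> (\<psi> x))"
  by (simp add: ring_map_def)

lemma ring_map_of_subst:
  assumes "ring_map \<phi>" "ring_map \<iota>"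
  shows "\<phi> (subst \<iota> u v P) = subst (\<lambda>c. \<phi> (\<iota> c)) (\<phi> u) (\<phi> v) P"
proof -
  interpret ring_map \<phi> by fact
  show ?thesis
    using ring_map_comp[OF assms]
    by (simp add: subst_sum assms sum case_prod_unfold mult power)
qed

definition const2 :: "complex \<Rightarrow> bipoly" where "const2 c = [:[:c:]:]"
definition X2 :: bipoly where "X2 = [:[:0, 1:]:]"
definition Y2 :: bipoly where "Y2 = [:0, 1:]"

lemma ring_map_const2: "ring_map const2"
  by unfold_locales (simp_all add: const2_def one_pCons)

lemma ring_map_ident: "ring_map (\<lambda>x. x)"
  by unfold_locales simp_all

lemma ring_map_eval2: "ring_map (\<lambda>h. eval2 h p)"
  by unfold_locales (simp_all add: eval2_def case_prod_unfold)

lemmas eval2_simps = ring_map.add[OF ring_map_eval2] ring_map.mult[OF ring_map_eval2]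
  ring_map.diff[OF ring_map_eval2] ring_map.power[OF ring_map_eval2] ring_map.zero[OF ring_map_eval2]

lemma eval2_const2 [simp]: "eval2 (const2 c) p = c"
  and eval2_X2 [simp]: "eval2 X2 p = fst p"
  and eval2_Y2 [simp]: "eval2 Y2 p = snd p"
  by (simp_all add: eval2_def const2_def X2_def Y2_def case_prod_unfold)

lemma eval2_eq_poly: "eval2 P (a, b) = poly (map_poly (\<lambda>p. poly p a) P) b"
  by (induction P) (simp_all add: eval2_def map_poly_pCons)

lemma eval2_eq_subst: "eval2 P p = subst (\<lambda>c. c) (fst p) (snd p) P"
  by (cases p) (simp add: eval2_eq_poly subst_def)

lemma eval2_subst: "eval2 (subst const2 f g P) p = eval2 P (eval2 f p, eval2 g p)"
  using ring_map_of_subst[OF ring_map_eval2 ring_map_const2, of f g P p]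
  by (simp add: eval2_eq_subst[of P])

text \<open>
  Identities between polynomials obtained by substitution can be checked pointwise, because \<open>\<complex>\<close>
  is infinite.
\<close>
lemma bipoly_eqI: "(\<And>p. eval2 g p = eval2 h p) \<Longrightarrow> g = h"
  using eval2_inject[of g h] by auto

lemma subst_X2_Y2: "subst const2 X2 Y2 P = P"
  by (rule bipoly_eqI) (simp add: eval2_subst)

section \<open>Weighted degree and leading forms\<close>

text \<open>
  The weighted homogeneous component of weight \<open>d\<close>.
\<close>
definition wpart :: "nat \<times> nat \<Rightarrow> nat \<Rightarrow> bipoly \<Rightarrow> bipoly" where
  "wpart w d P = (\<Sum>(i, j)\<in>{(i, j)\<in>supp2 P. i * fst w + j * snd w = d}. monom (monom (coeff2 P i j) i) j)"

lemma coeff2_wpart: "coeff2 (wpart w d P) i j = (if i * fst w + j * snd w = d then coeff2 P i j else 0)"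
proof -
  let ?S = "{(i, j)\<in>supp2 P. i * fst w + j * snd w = d}"
  have fin: "finite ?S" by (rule finite_subset[OF _ finite_supp2]) auto
  have "coeff2 (wpart w d P) i j = (\<Sum>(i', j')\<in>?S. if (i', j') = (i, j) then coeff2 P i j else 0)"
    unfolding wpart_def coeff2_def[of "sum _ _"] coeff_sum by (intro sum.cong) (auto simp: coeff_monom)
  also have "\<dots> = (\<Sum>p\<in>?S. if p = (i, j) then coeff2 P i j else 0)"
    by (intro sum.cong) (auto split: if_splits)
  also have "\<dots> = (if (i, j) \<in> ?S then coeff2 P i j else 0)"
    using fin by (simp add: sum.delta)
  finally show ?thesis by (auto simp: supp2_def)
qed

lemma bipoly_coeff2_eqI: "(\<And>i j. coeff2 g i j = coeff2 h i j) \<Longrightarrow> g = h"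
  by (simp add: coeff2_def poly_eq_iff)

abbreviation tconst :: "complex \<Rightarrow> bipoly poly" where "tconst c \<equiv> [:const2 c:]"

lemma ring_map_tconst: "ring_map tconst"
  by unfold_locales (simp_all add: const2_def one_pCons)

lemma coeff_mult_top:
  fixes p q :: "'a::comm_ring_1 poly"
  assumes "degree p \<le> m" "degree q \<le> n"
  shows "coeff (p * q) (m + n) = coeff p m * coeff q n"
proof -
  have "coeff (p * q) (m + n) = (\<Sum>i\<le>m + n. if i = m then coeff p m * coeff q n else 0)"
    unfolding coeff_mult
  proof (intro sum.cong refl)
    fix i
    show "coeff p i * coeff q (m + n - i) = (if i = m then coeff p m * coeff q n else 0)"
      using assms by (cases i m rule: linorder_cases) (auto simp: coeff_eq_0)
  qed
  then show ?thesis by simp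
qed

lemma coeff_power_top:
  fixes p :: "'a::comm_ring_1 poly"
  assumes "degree p \<le> m"
  shows "degree (p ^ k) \<le> k * m" "coeff (p ^ k) (k * m) = coeff p m ^ k"
proof -
  show le: "degree (p ^ k) \<le> k * m" for k
    using degree_power_le[of p k] assms by (metis mult.commute le_trans mult_le_mono2)
  show "coeff (p ^ k) (k * m) = coeff p m ^ k"
    using coeff_mult_top[OF assms le] by (induction k) simp_all
qed

text \<open>
  If \<open>u\<close> and \<open>v\<close> have degrees at most \<open>m\<close> and \<open>n\<close> in \<open>t\<close>, then a monomial \<open>x\<^sup>i y\<^sup>j\<close> of \<open>P\<close>
  contributes to \<open>t\<^sup>W\<close> only if its \<open>(m, n)\<close>-weight is the largest possible one, \<open>W\<close>, and then
  only through the coefficients of \<open>t\<^sup>m\<close> and \<open>t\<^sup>n\<close>. The coefficient of \<open>t\<^sup>W\<close> may vanish: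
  this cancellation is what the rest of the proof has to control.
\<close>
lemma subst_top:
  fixes u v :: "bipoly poly"
  assumes u: "degree u \<le> m" and v: "degree v \<le> n"
    and W: "\<And>i j. coeff2 P i j \<noteq> 0 \<Longrightarrow> i * m + j * n \<le> W"
  shows "degree (subst tconst u v P) \<le> W"
    and "coeff (subst tconst u v P) W = subst const2 (coeff u m) (coeff v n) (wpart (m, n) W P)"
proof -
  let ?t = "\<lambda>i j. tconst (coeff2 P i j) * u ^ i * v ^ j"
  have deg: "degree (u ^ i * v ^ j) \<le> i * m + j * n" for i j
    using degree_mult_le[of "u ^ i" "v ^ j"] coeff_power_top(1)[OF u, of i] coeff_power_top(1)[OF v, of j] by simp
  have top: "coeff (u ^ i * v ^ j) (i * m + j * n) = coeff u m ^ i * coeff v n ^ j" for i j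
    by (simp add: coeff_mult_top coeff_power_top u v)
  have t: "?t i j = smult (const2 (coeff2 P i j)) (u ^ i * v ^ j)" for i j
    by simp
  have degt: "degree (?t i j) \<le> i * m + j * n" for i j
    unfolding t using deg order.trans[OF degree_smult_le] by blast
  show "degree (subst tconst u v P) \<le> W"
    unfolding subst_sum[OF ring_map_tconst]
    by (intro degree_sum_le finite_supp2)
       (auto simp del: mult_pCons_left simp: supp2_def intro: order.trans[OF degt W])
  have "coeff (?t i j) W = (if i * m + j * n = W then const2 (coeff2 P i j) * coeff u m ^ i * coeff v n ^ j else 0)"
    if "(i, j) \<in> supp2 P" for i j
  proof (cases "i * m + j * n = W")
    case True
    then show ?thesis unfolding t using top[of i j] by (simp add: mult.assoc)
  next
    case False
    then have "i * m + j * n < W" using W[of i j] that by (auto simp: supp2_def)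
    then show ?thesis using False degt[of i j] by (intro trans[OF coeff_eq_0]) auto
  qed
  then have "coeff (subst tconst u v P) W = (\<Sum>(i, j)\<in>supp2 P. if i * m + j * n = W then const2 (coeff2 P i j) * coeff u m ^ i * coeff v n ^ j else 0)"
    unfolding subst_sum[OF ring_map_tconst] coeff_sum by (intro sum.cong) auto
  also have "\<dots> = (\<Sum>(i, j)\<in>supp2 (wpart (m, n) W P). const2 (coeff2 (wpart (m, n) W P) i j) * coeff u m ^ i * coeff v n ^ j)"
    by (rule sum.mono_neutral_cong_right[OF finite_supp2]) (auto simp: supp2_def coeff2_wpart split: if_splits)
  finally show "coeff (subst tconst u v P) W = subst const2 (coeff u m) (coeff v n) (wpart (m, n) W P)"
    by (simp add: subst_sum[OF ring_map_const2])
qed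

lemma wdeg_ge: "coeff2 h i j \<noteq> 0 \<Longrightarrow> i * fst w + j * snd w \<le> wdeg w h"
  unfolding wdeg_def by (rule Max_ge[OF finite_wdeg_set]) blast

lemma wdeg_attained:
  assumes "h \<noteq> 0"
  obtains i j where "coeff2 h i j \<noteq> 0" "i * fst w + j * snd w = wdeg w h"
proof -
  have "wdeg w h \<in> {i * fst w + j * snd w | i j. coeff2 h i j \<noteq> 0}"
    unfolding wdeg_def using coeff2_nonzero_ex[OF assms] by (intro Max_in finite_wdeg_set) auto
  then show ?thesis using that by force
qed

lemma wdeg_le:
  assumes "h \<noteq> 0" "\<And>i j. coeff2 h i j \<noteq> 0 \<Longrightarrow> i * fst w + j * snd w \<le> d"
  shows "wdeg w h \<le> d"
  using wdeg_attained[OF assms(1)] assms(2) by metis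

text \<open>
  This is \<open>h (x t\<^bsup>w\<^sub>1\<^esup>, y t\<^bsup>w\<^sub>2\<^esup>)\<close> as a polynomial in \<open>t\<close> over \<open>\<complex>[x,y]\<close>. It turns the weighted degree
  into an ordinary degree over an integral domain, so that additivity on products and the
  multiplicativity of leading forms are inherited from univariate polynomials.
\<close>
definition homog :: "nat \<times> nat \<Rightarrow> bipoly \<Rightarrow> bipoly poly" where
  "homog w = subst tconst (monom X2 (fst w)) (monom Y2 (snd w))"

lemma ring_map_homog: "ring_map (homog w)"
  unfolding homog_def by (intro ring_map_subst ring_map_tconst)

lemma wpart_wdeg_nonzero:
  assumes "h \<noteq> 0" shows "wpart w (wdeg w h) h \<noteq> 0"
proof -
  obtain i j where "coeff2 h i j \<noteq> 0" "i * fst w + j * snd w = wdeg w h"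
    using wdeg_attained[OF assms] by metis
  then have "coeff2 (wpart w (wdeg w h) h) i j \<noteq> 0" by (simp add: coeff2_wpart)
  then show ?thesis by (auto simp: coeff2_def)
qed

lemma degree_homog:
  assumes "h \<noteq> 0" shows "degree (homog w h) = wdeg w h"
proof -
  note top = subst_top[OF degree_monom_le degree_monom_le, of h "fst w" "snd w" "wdeg w h" X2 Y2]
  have *: "i * fst w + j * snd w \<le> wdeg w h" if "coeff2 h i j \<noteq> 0" for i j
    using wdeg_ge[OF that] .
  have "degree (homog w h) \<le> wdeg w h"
    unfolding homog_def using top(1) * by blast
  moreover have "coeff (homog w h) (wdeg w h) = wpart w (wdeg w h) h"
    unfolding homog_def using top(2) * by (simp add: subst_X2_Y2)
  ultimately show ?thesis
    using wpart_wdeg_nonzero[OF assms] by (metis le_antisym le_degree)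
qed

lemma homog_eq_0_iff: "homog w h = 0 \<longleftrightarrow> h = 0"
proof
  assume 0: "homog w h = 0"
  show "h = 0"
  proof (rule ccontr)
    assume "h \<noteq> 0"
    have "coeff (homog w h) (wdeg w h) = wpart w (wdeg w h) h"
      unfolding homog_def using subst_top(2)[OF degree_monom_le degree_monom_le, of h "fst w" "snd w" "wdeg w h" X2 Y2]
      wdeg_ge[of h] by (simp add: subst_X2_Y2)
    then show False using 0 wpart_wdeg_nonzero[OF \<open>h \<noteq> 0\<close>, of w] by simp
  qed
qed (simp add: ring_map.zero[OF ring_map_homog])

lemma wdeg_mult: "g \<noteq> 0 \<Longrightarrow> h \<noteq> 0 \<Longrightarrow> wdeg w (g * h) = wdeg w g + wdeg w h"
  using degree_mult_eq[of "homog w g" "homog w h"]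
  by (simp add: degree_homog[symmetric] homog_eq_0_iff ring_map.mult[OF ring_map_homog])

lemma homog_const2: "homog w (const2 c) = tconst c"
  unfolding homog_def by (simp add: subst_def const2_def map_poly_pCons)

lemma homog_subst: "homog w (subst const2 f g P) = subst tconst (homog w f) (homog w g) P"
  using ring_map_of_subst[OF ring_map_homog ring_map_const2, of w f g P] by (simp add: homog_const2)

section \<open>Derivations and the Jacobian\<close>

text \<open>
  Differentiation in \<open>y\<close>, the outer indeterminate, is \<open>pderiv\<close> itself.
\<close>
definition dx :: "bipoly \<Rightarrow> bipoly" where "dx = map_poly pderiv"

lemma dx_add: "dx (p + q) = dx p + dx q"
  by (simp add: dx_def poly_eq_iff coeff_map_poly pderiv_add)

lemma pderiv_sum: "pderiv (\<Sum>i\<in>A. h i) = (\<Sum>i\<in>A. pderiv (h i))"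
  by (induction A rule: infinite_finite_induct) (simp_all add: pderiv_add)

lemma dx_mult: "dx (p * q) = dx p * q + p * dx q"
proof (rule poly_eqI)
  fix n
  have leibniz: "pderiv (a * b) = pderiv a * b + a * pderiv b" for a b :: "complex poly"
    by (simp add: pderiv_mult)
  have "coeff (dx (p * q)) n = (\<Sum>i\<le>n. pderiv (coeff p i * coeff q (n - i)))"
    by (simp add: dx_def coeff_map_poly coeff_mult pderiv_sum)
  also have "\<dots> = coeff (dx p * q + p * dx q) n"
    by (simp add: dx_def coeff_map_poly coeff_mult leibniz sum.distrib)
  finally show "coeff (dx (p * q)) n = coeff (dx p * q + p * dx q) n" .
qed

lemma dx_const2: "dx (const2 c) = 0"
  by (simp add: dx_def const2_def map_poly_pCons)

lemma coeff2_dx: "coeff2 (dx h) i j = of_nat (Suc i) * coeff2 h (Suc i) j"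
  by (simp add: coeff2_def dx_def coeff_map_poly coeff_pderiv)

lemma coeff2_pderiv: "coeff2 (pderiv h) i j = of_nat (Suc j) * coeff2 h i (Suc j)"
  by (simp add: coeff2_def coeff_pderiv of_nat_poly del: of_nat_Suc)

definition jacobian :: "bipoly \<Rightarrow> bipoly \<Rightarrow> bipoly" where
  "jacobian f g = dx f * pderiv g - pderiv f * dx g"

text \<open>
  The chain rule holds for every derivation that kills the constants; it is needed for
  \<open>\<partial>/\<partial>x\<close> and \<open>\<partial>/\<partial>y\<close>.
\<close>
lemma derivation_subst:
  assumes add: "\<And>a b. D (a + b) = D a + D b"
    and mult: "\<And>a b. D (a * b) = D a * b + a * D b"
    and const: "\<And>c. D (const2 c) = 0"
  shows "D (subst const2 f g P) = subst const2 f g (dx P) * D f + subst const2 f g (pderiv P) * D g"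
proof -
  interpret c: ring_map const2 by (rule ring_map_const2)
  let ?s = "\<lambda>p. poly (map_poly const2 p) f"
  interpret s: ring_map ?s by (rule ring_map_poly[OF ring_map_const2])
  interpret t: ring_map "subst const2 f g" by (rule ring_map_subst[OF ring_map_const2])
  have subst_pCons: "subst const2 f g (pCons p Q) = ?s p + g * subst const2 f g Q" for p Q
    by (simp add: subst_def map_poly_pCons s.zero)
  have D0: "D 0 = 0" using const[of 0] by (simp add: const2_def)
  have s_pCons: "?s (pCons c q) = const2 c + f * ?s q" for c q
    by (simp add: map_poly_pCons c.zero)
  have inner: "D (?s p) = ?s (pderiv p) * D f" for p
  proof (induction p)
    case (pCons c p)
    have "?s (pderiv (pCons c p)) = ?s p + f * ?s (pderiv p)"
      by (simp add: pderiv_pCons s.add s_pCons c.zero)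
    then show ?case using pCons by (simp add: s_pCons add mult const algebra_simps)
  qed (simp add: D0)
  show ?thesis
  proof (induction P)
    case (pCons p P)
    have "subst const2 f g (dx (pCons p P)) = ?s (pderiv p) + g * subst const2 f g (dx P)"
      by (simp add: dx_def map_poly_pCons subst_pCons)
    moreover have "subst const2 f g (pderiv (pCons p P)) = subst const2 f g P + g * subst const2 f g (pderiv P)"
      by (simp add: pderiv_pCons t.add subst_pCons s.zero)
    ultimately show ?case using pCons by (simp add: subst_pCons add mult inner algebra_simps)
  qed (simp add: D0 dx_def t.zero)
qed

lemma dx_subst:
  "dx (subst const2 f g P) = subst const2 f g (dx P) * dx f + subst const2 f g (pderiv P) * dx g"
  by (rule derivation_subst) (rule dx_add dx_mult dx_const2)+

lemma pderiv_subst: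
  "pderiv (subst const2 f g P) = subst const2 f g (dx P) * pderiv f + subst const2 f g (pderiv P) * pderiv g"
  by (rule derivation_subst) (simp_all add: pderiv_add pderiv_mult const2_def pderiv_pCons algebra_simps)

text \<open>
  The derivation \<open>jacobian f\<close> kills \<open>f\<close>, so on polynomials in \<open>f\<close> and \<open>g\<close> it acts as
  differentiation with respect to \<open>g\<close>, multiplied by \<open>jacobian f g\<close>.
\<close>
lemma jacobian_subst: "jacobian f (subst const2 f g P) = jacobian f g * subst const2 f g (pderiv P)"
  unfolding jacobian_def dx_subst pderiv_subst by (simp add: algebra_simps)

lemma wdeg_dx: "dx h \<noteq> 0 \<Longrightarrow> wdeg (w1, w2) (dx h) + w1 \<le> wdeg (w1, w2) h"
proof -
  assume "dx h \<noteq> 0"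
  then obtain i j where ij: "coeff2 (dx h) i j \<noteq> 0" "i * w1 + j * w2 = wdeg (w1, w2) (dx h)"
    using wdeg_attained[of "dx h" "(w1, w2)"] by auto
  then have "Suc i * w1 + j * w2 \<le> wdeg (w1, w2) h"
    using wdeg_ge[of h "Suc i" j "(w1, w2)"] by (simp add: coeff2_dx)
  then show ?thesis using ij by simp
qed

lemma wdeg_pderiv: "pderiv h \<noteq> 0 \<Longrightarrow> wdeg (w1, w2) (pderiv h) + w2 \<le> wdeg (w1, w2) h"
proof -
  assume "pderiv h \<noteq> 0"
  then obtain i j where ij: "coeff2 (pderiv h) i j \<noteq> 0" "i * w1 + j * w2 = wdeg (w1, w2) (pderiv h)"
    using wdeg_attained[of "pderiv h" "(w1, w2)"] by auto
  then have "i * w1 + Suc j * w2 \<le> wdeg (w1, w2) h"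
    using wdeg_ge[of h i "Suc j" "(w1, w2)"] by (simp add: coeff2_pderiv)
  then show ?thesis using ij by simp
qed

text \<open>
  Each term of the Jacobian is differentiated once in \<open>x\<close> and once in \<open>y\<close>, which costs \<open>w1 + w2\<close>.
\<close>
lemma wdeg_jacobian:
  assumes "jacobian f g \<noteq> 0"
  shows "wdeg (w1, w2) (jacobian f g) + w1 + w2 \<le> wdeg (w1, w2) f + wdeg (w1, w2) g"
proof -
  have prod: "i * w1 + j * w2 \<le> wdeg (w1, w2) p + wdeg (w1, w2) q" "p \<noteq> 0" "q \<noteq> 0"
    if "coeff2 (p * q) i j \<noteq> 0" for p q i j
  proof -
    show "p \<noteq> 0" "q \<noteq> 0" using that by (auto simp: coeff2_def)
    then show "i * w1 + j * w2 \<le> wdeg (w1, w2) p + wdeg (w1, w2) q"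
      using wdeg_ge[OF that, of "(w1, w2)"] by (simp add: wdeg_mult)
  qed
  obtain i j where ij: "coeff2 (jacobian f g) i j \<noteq> 0" "i * w1 + j * w2 = wdeg (w1, w2) (jacobian f g)"
    using wdeg_attained[OF assms, of "(w1, w2)"] by auto
  then have "coeff2 (dx f * pderiv g) i j \<noteq> 0 \<or> coeff2 (pderiv f * dx g) i j \<noteq> 0"
    by (auto simp: jacobian_def coeff2_def)
  then show ?thesis
    using prod[of "dx f" "pderiv g" i j] prod[of "pderiv f" "dx g" i j] ij(2)
      wdeg_dx[of f w1 w2] wdeg_dx[of g w1 w2] wdeg_pderiv[of f w1 w2] wdeg_pderiv[of g w1 w2]
    by linarith
qed

section \<open>A lower bound for the degree of a polynomial in two polynomials\<close>

lemma wpart_pderiv_funpow: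
  "wpart (m, n) d ((pderiv ^^ k) P) = (pderiv ^^ k) (wpart (m, n) (d + k * n) P)"
proof (induction k arbitrary: d)
  case (Suc k)
  have "wpart (m, n) d (pderiv Q) = pderiv (wpart (m, n) (d + n) Q)" for Q
    by (rule bipoly_coeff2_eqI) (simp add: coeff2_wpart coeff2_pderiv algebra_simps)
  then show ?case by (simp add: Suc add.assoc)
qed simp

lemma coeff2_pderiv_funpow: "coeff2 ((pderiv ^^ k) P) i j \<noteq> 0 \<Longrightarrow> coeff2 P i (j + k) \<noteq> 0"
  by (induction k arbitrary: j) (force simp: coeff2_pderiv)+

text \<open>
  A polynomial with \<open>N\<close> monomials vanishes at a nonzero point to an order less than \<open>N\<close>.
  Dividing by a power of the variable keeps the order and the number of monomials; once there
  is a constant term, differentiation lowers both by exactly one.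
\<close>
lemma pderiv_sparse_nonvanishing:
  fixes q :: "complex poly"
  assumes "q \<noteq> 0" "\<beta> \<noteq> 0"
  shows "\<exists>k < card {j. coeff q j \<noteq> 0}. poly ((pderiv ^^ k) q) \<beta> \<noteq> 0"
proof -
  have fin: "finite {j. coeff p j \<noteq> 0}" for p :: "complex poly"
    by (rule finite_subset[of _ "{..degree p}"]) (auto intro: le_degree)
  have "order \<beta> q < card {j. coeff q j \<noteq> 0}" using \<open>q \<noteq> 0\<close>
  proof (induction "degree q" arbitrary: q rule: less_induct)
    case less
    show ?case
    proof (cases "coeff q 0 = 0")
      case True
      then obtain p where p: "q = pCons 0 p" by (cases q) auto
      then have "p \<noteq> 0" using less.prems by auto
      have q: "q = [:0, 1:] * p" by (simp add: p)
      have "order \<beta> [:0, 1:] = 0" using \<open>\<beta> \<noteq> 0\<close> by (intro order_0I) simp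
      then have "order \<beta> q = order \<beta> p"
        using less.prems unfolding q by (subst order_mult) simp_all
      moreover have "{j. coeff q j \<noteq> 0} = Suc ` {j. coeff p j \<noteq> 0}"
        by (auto simp: p coeff_pCons image_iff gr0_conv_Suc split: nat.splits)
      then have "card {j. coeff q j \<noteq> 0} = card {j. coeff p j \<noteq> 0}"
        by (simp add: card_image)
      ultimately show ?thesis
        using less.hyps[of p] \<open>p \<noteq> 0\<close> by (simp add: p)
    next
      case False
      show ?thesis
      proof (cases "poly q \<beta> = 0")
        case True
        have "pderiv q \<noteq> 0"
        proof
          assume "pderiv q = 0"
          then have "degree q = 0" by (simp add: pderiv_eq_0_iff)
          then obtain c where "q = [:c:]" by (metis degree_eq_zeroE)
          then show False using True less.prems by simp
        qed
        then have deg: "degree (pderiv q) < degree q"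
          by (simp add: degree_pderiv pderiv_eq_0_iff)
        have "order \<beta> q = Suc (order \<beta> (pderiv q))"
          using \<open>pderiv q \<noteq> 0\<close> True less.prems by (intro order_pderiv) (auto simp: order_root)
        moreover have "{j. coeff q j \<noteq> 0} = insert 0 (Suc ` {j. coeff (pderiv q) j \<noteq> 0})"
          using False by (auto simp: coeff_pderiv image_iff dest: not0_implies_Suc simp del: of_nat_Suc)
        then have "card {j. coeff q j \<noteq> 0} = Suc (card {j. coeff (pderiv q) j \<noteq> 0})"
          using fin by (simp add: card_image)
        ultimately show ?thesis using less.hyps[OF deg \<open>pderiv q \<noteq> 0\<close>] by simp
      next
        case False
        then have "order \<beta> q = 0" by (rule order_0I)
        moreover have "{j. coeff q j \<noteq> 0} \<noteq> {}" using less.prems by (auto simp: poly_eq_iff)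
        ultimately show ?thesis using fin by (simp add: card_gt_0_iff)
      qed
    qed
  qed
  moreover have "poly ((pderiv ^^ order \<beta> q) q) \<beta> \<noteq> 0" using \<open>q \<noteq> 0\<close>
  proof (induction "order \<beta> q" arbitrary: q)
    case 0
    then show ?case by (auto simp: order_root)
  next
    case (Suc k)
    have root: "poly q \<beta> = 0" using Suc.hyps(2) by (auto simp: order_root)
    have nz: "pderiv q \<noteq> 0"
    proof
      assume "pderiv q = 0"
      then obtain c where "q = [:c:]" by (metis degree_eq_zeroE pderiv_eq_0_iff)
      then show False using root Suc.prems by simp
    qed
    have "order \<beta> q = Suc (order \<beta> (pderiv q))"
      using nz root Suc.prems by (intro order_pderiv) (auto simp: order_root)
    then have "k = order \<beta> (pderiv q)" using Suc.hyps(2) by simp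
    then have "poly ((pderiv ^^ k) (pderiv q)) \<beta> \<noteq> 0" using Suc.hyps(1) nz by blast
    then show ?case by (simp add: Suc.hyps(2)[symmetric] funpow_swap1)
  qed
  ultimately show ?thesis by blast
qed

text \<open>
  In a weighted homogeneous polynomial the exponent of \<open>y\<close> determines that of \<open>x\<close>.
\<close>
lemma coeff_wpart:
  assumes "m > 0" "coeff (wpart (m, n) d P) j \<noteq> 0"
  shows "\<exists>i. i * m + j * n = d \<and> coeff2 P i j \<noteq> 0 \<and> coeff (wpart (m, n) d P) j = monom (coeff2 P i j) i"
proof -
  let ?p = "coeff (wpart (m, n) d P) j"
  have c: "coeff ?p i = (if i * m + j * n = d then coeff2 P i j else 0)" for i
    using coeff2_wpart[of "(m, n)" d P i j] by (simp add: coeff2_def)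
  obtain i where i: "coeff ?p i \<noteq> 0" using assms(2) by (auto simp: poly_eq_iff)
  then have "i * m + j * n = d" "coeff2 P i j \<noteq> 0" using c by (auto split: if_splits)
  moreover have "?p = monom (coeff2 P i j) i"
  proof (rule poly_eqI)
    fix i'
    have "i' * m + j * n = d \<longleftrightarrow> i' = i"
      using \<open>i * m + j * n = d\<close> \<open>m > 0\<close> by auto
    then show "coeff ?p i' = coeff (monom (coeff2 P i j) i) i'" by (simp add: c)
  qed
  ultimately show ?thesis by blast
qed

lemma wpart_slice_coeff:
  assumes "m > 0" "\<alpha> \<noteq> 0"
  shows "coeff (map_poly (\<lambda>p. poly p \<alpha>) (wpart (m, n) d P)) j \<noteq> 0 \<longleftrightarrow> coeff (wpart (m, n) d P) j \<noteq> 0"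
proof -
  have "poly (coeff (wpart (m, n) d P) j) \<alpha> \<noteq> 0" if nz: "coeff (wpart (m, n) d P) j \<noteq> 0"
  proof -
    obtain i where "coeff2 P i j \<noteq> 0" "coeff (wpart (m, n) d P) j = monom (coeff2 P i j) i"
      using coeff_wpart[OF assms(1) nz] by blast
    then show ?thesis using assms(2) by (simp add: poly_monom)
  qed
  then show ?thesis by (auto simp: coeff_map_poly)
qed

text \<open>
  If \<open>y\<^sup>j\<close> and \<open>y\<^bsup>j'\<^esup>\<close> both occur in a form of weight \<open>d\<close>, then \<open>(j' - j) n\<close> is a multiple of
  \<open>m\<close> as well as of \<open>n\<close>. Hence distinct values of \<open>j n\<close> are at least \<open>lcm m n\<close> apart, and none
  exceeds \<open>d\<close>.
\<close>
lemma wpart_slice_card: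
  assumes "m > 0" "n > 0"
  shows "card {j. coeff (wpart (m, n) d P) j \<noteq> 0} \<le> d div lcm m n + 1"
proof -
  let ?S = "{j. coeff (wpart (m, n) d P) j \<noteq> 0}" and ?f = "\<lambda>j. j * n div lcm m n"
  have S: "\<exists>i. i * m + j * n = d" if "j \<in> ?S" for j
    using coeff_wpart[OF assms(1)] that by blast
  have "inj_on ?f ?S"
  proof -
    have aux: "j = j'" if j: "j \<in> ?S" "j' \<in> ?S" "?f j = ?f j'" "j \<le> j'" for j j'
    proof -
      obtain i i' where i: "i * m + j * n = d" "i' * m + j' * n = d" using S j by blast
      have le: "j * n \<le> j' * n" using \<open>j \<le> j'\<close> by simp
      have "i' * m \<le> i * m" using i le by linarith
      then have "j' * n - j * n = (i - i') * m" using i le by (simp add: diff_mult_distrib)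
      then have "m dvd j' * n - j * n" by simp
      moreover have "n dvd j' * n - j * n" by (simp add: diff_mult_distrib[symmetric])
      ultimately have "lcm m n dvd j' * n - j * n" by (rule lcm_least)
      then obtain t where "j' * n - j * n = lcm m n * t" by (rule dvdE)
      then have t: "j' * n = j * n + lcm m n * t" using le by linarith
      have "lcm m n \<noteq> 0" using assms by simp
      then have "?f j' = ?f j + t" unfolding t by simp
      then have "t = 0" using j(3) by simp
      then have "j * n = j' * n" using t by auto
      then show "j = j'" using assms by simp
    qed
    show ?thesis by (rule inj_onI) (metis aux nle_le)
  qed
  moreover have "?f ` ?S \<subseteq> {..d div lcm m n}"
  proof safe
    fix j assume "coeff (wpart (m, n) d P) j \<noteq> 0"
    then obtain i where "i * m + j * n = d" using S by blast
    then show "?f j \<le> d div lcm m n" by (intro div_le_mono) linarith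
  qed
  ultimately have "card ?S \<le> card {..d div lcm m n}"
    by (intro card_inj_on_le) auto
  then show ?thesis by simp
qed

lemma pderiv_funpow_slice:
  "map_poly (\<lambda>p. poly p \<alpha>) ((pderiv ^^ k) P) = (pderiv ^^ k) (map_poly (\<lambda>p. poly p \<alpha>) P)"
proof (induction k)
  case (Suc k)
  have "map_poly (\<lambda>p. poly p \<alpha>) (pderiv Q) = pderiv (map_poly (\<lambda>p. poly p \<alpha>) Q)" for Q
    by (simp add: poly_eq_iff coeff_map_poly coeff_pderiv)
  then show ?case using Suc by simp
qed simp

lemma common_nonzero_point:
  assumes "u \<noteq> 0" "v \<noteq> (0::bipoly)"
  obtains p where "eval2 u p \<noteq> 0" "eval2 v p \<noteq> 0"
proof -
  have "u * v \<noteq> 0" using assms by simp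
  then obtain p where "eval2 (u * v) p \<noteq> 0"
    using bipoly_eqI[of "u * v" 0] by (auto simp: eval2_simps)
  then show ?thesis using that[of p] by (simp add: eval2_simps)
qed

text \<open>
  Even when a relation between \<open>u\<close> and \<open>v\<close> makes the form vanish at \<open>(u, v)\<close>, few derivatives in
  the second variable remove the vanishing. At a point where \<open>u\<close> and \<open>v\<close> take nonzero values
  \<open>\<alpha>\<close> and \<open>\<beta>\<close>, the form restricted to \<open>x = \<alpha>\<close> is a sparse polynomial in \<open>y\<close>, and its order of
  vanishing at \<open>\<beta>\<close> is bounded by the number of its monomials.
\<close>
lemma wpart_pderiv_nonvanishing:
  assumes "m > 0" "n > 0" and u: "u \<noteq> 0" and v: "v \<noteq> 0" and P: "wpart (m, n) d P \<noteq> 0"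
  shows "\<exists>k. k * lcm m n \<le> d \<and> subst const2 u v ((pderiv ^^ k) (wpart (m, n) d P)) \<noteq> 0"
proof -
  obtain p where p: "eval2 u p \<noteq> 0" "eval2 v p \<noteq> 0" using common_nonzero_point[OF u v] .
  let ?q = "map_poly (\<lambda>p'. poly p' (eval2 u p)) (wpart (m, n) d P)"
  have supp: "{j. coeff ?q j \<noteq> 0} = {j. coeff (wpart (m, n) d P) j \<noteq> 0}"
    using wpart_slice_coeff[OF assms(1) p(1)] by auto
  have "?q \<noteq> 0" using supp P by (auto simp: poly_eq_iff)
  then obtain k where k: "k < card {j. coeff ?q j \<noteq> 0}" "poly ((pderiv ^^ k) ?q) (eval2 v p) \<noteq> 0"
    using pderiv_sparse_nonvanishing p(2) by blast
  have "k \<le> d div lcm m n"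
    using k(1) wpart_slice_card[OF assms(1,2), of d P] unfolding supp by linarith
  then have "k * lcm m n \<le> d"
    using div_times_less_eq_dividend[of d "lcm m n"] by (meson le_trans mult_le_mono1)
  moreover have "eval2 (subst const2 u v ((pderiv ^^ k) (wpart (m, n) d P))) p \<noteq> 0"
    using k(2) by (simp add: eval2_subst eval2_eq_poly pderiv_funpow_slice)
  then have "subst const2 u v ((pderiv ^^ k) (wpart (m, n) d P)) \<noteq> 0"
    by (auto simp: eval2_simps)
  ultimately show ?thesis by blast
qed

text \<open>
  The leading form for the weight \<open>w\<close>.
\<close>
definition topform :: "nat \<times> nat \<Rightarrow> bipoly \<Rightarrow> bipoly" where
  "topform w h = lead_coeff (homog w h)"

lemma topform_nonzero: "h \<noteq> 0 \<Longrightarrow> topform w h \<noteq> 0"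
  by (simp add: topform_def homog_eq_0_iff)

lemma wdeg_subst_ge:
  assumes "f \<noteq> 0" "g \<noteq> 0" "m = wdeg w f" "n = wdeg w g"
    and W: "\<And>i j. coeff2 P i j \<noteq> 0 \<Longrightarrow> i * m + j * n \<le> d"
    and nz: "subst const2 (topform w f) (topform w g) (wpart (m, n) d P) \<noteq> 0"
  shows "subst const2 f g P \<noteq> 0" "d \<le> wdeg w (subst const2 f g P)"
proof -
  have "coeff (homog w (subst const2 f g P)) d \<noteq> 0"
    using subst_top(2)[of "homog w f" m "homog w g" n P d] assms
    by (simp add: homog_subst topform_def degree_homog)
  then have "homog w (subst const2 f g P) \<noteq> 0" "d \<le> degree (homog w (subst const2 f g P))"
    by (auto intro: le_degree)
  then show "subst const2 f g P \<noteq> 0" "d \<le> wdeg w (subst const2 f g P)"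
    by (simp_all add: homog_eq_0_iff degree_homog)
qed

text \<open>
  One application of \<open>jacobian f\<close> raises the degree by at most \<open>wdeg f - w1 - w2\<close>, and multiplying
  by the nonzero polynomial \<open>jacobian f g\<close> does not lower it.
\<close>
lemma wdeg_subst_pderiv_funpow:
  assumes J: "jacobian f g \<noteq> 0" and nz: "subst const2 f g ((pderiv ^^ k) P) \<noteq> 0"
  shows "wdeg (w1, w2) (subst const2 f g ((pderiv ^^ k) P)) + k * (w1 + w2)
    \<le> wdeg (w1, w2) (subst const2 f g P) + k * wdeg (w1, w2) f"
  using nz
proof (induction k)
  case (Suc k)
  let ?h = "subst const2 f g ((pderiv ^^ k) P)" and ?h' = "subst const2 f g ((pderiv ^^ Suc k) P)"
  have eq: "jacobian f ?h = jacobian f g * ?h'" by (simp add: jacobian_subst)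
  then have nz: "jacobian f ?h \<noteq> 0" using J Suc.prems by simp
  then have "?h \<noteq> 0" by (auto simp: jacobian_def dx_def)
  moreover have "wdeg (w1, w2) ?h' \<le> wdeg (w1, w2) (jacobian f ?h)"
    unfolding eq using wdeg_mult[OF J Suc.prems] by simp
  ultimately show ?case
    using wdeg_jacobian[OF nz, of w1 w2] Suc.IH by (simp add: algebra_simps)
qed simp

text \<open>
  A version of the inequality of Shestakov and Umirbaev. The number \<open>k\<close> measures how much of
  the top form of \<open>P\<close> is lost at the leading forms of \<open>f\<close> and \<open>g\<close>. After \<open>k\<close> derivatives in the
  second variable nothing is lost any more, so the degree is known; going back by the
  derivation \<open>jacobian f\<close> costs at most \<open>m - w1 - w2\<close> each time.
\<close>
lemma wdeg_subst_lower_bound: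
  assumes J: "jacobian f g \<noteq> 0" and f: "f \<noteq> 0" and g: "g \<noteq> 0"
    and m: "m = wdeg (w1, w2) f" "m > 0" and n: "n = wdeg (w1, w2) g" "n > 0" and P: "P \<noteq> 0"
  shows "\<exists>k. k * lcm m n \<le> wdeg (m, n) P \<and>
    wdeg (m, n) P + k * (w1 + w2) \<le> wdeg (w1, w2) (subst const2 f g P) + k * (m + n)"
proof -
  let ?W = "wdeg (m, n) P"
  obtain k where k: "k * lcm m n \<le> ?W"
    and nz: "subst const2 (topform (w1, w2) f) (topform (w1, w2) g) ((pderiv ^^ k) (wpart (m, n) ?W P)) \<noteq> 0"
    using wpart_pderiv_nonvanishing[OF m(2) n(2) topform_nonzero[OF f] topform_nonzero[OF g]
        wpart_wdeg_nonzero[OF P]] by blast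
  have "k * n \<le> k * lcm m n" using m(2) n(2) by (intro mult_le_mono2 dvd_imp_le) (auto simp: lcm_pos_nat)
  then obtain d where d: "d + k * n = ?W" using k by (metis le_trans le_add_diff_inverse2)
  have part: "wpart (m, n) d ((pderiv ^^ k) P) = (pderiv ^^ k) (wpart (m, n) ?W P)"
    by (simp add: wpart_pderiv_funpow d)
  have W: "i * m + j * n \<le> d" if "coeff2 ((pderiv ^^ k) P) i j \<noteq> 0" for i j
    using wdeg_ge[OF coeff2_pderiv_funpow[OF that], of "(m, n)"] d by (simp add: algebra_simps)
  note ge = wdeg_subst_ge[OF f g m(1) n(1) W nz[folded part]]
  have "?W + k * (w1 + w2) \<le> wdeg (w1, w2) (subst const2 f g P) + k * (m + n)"
    using wdeg_subst_pderiv_funpow[OF J ge(1), of w1 w2] ge(2) d m(1) by (simp add: algebra_simps)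
  then show ?thesis using k by blast
qed

section \<open>Automorphisms and their inverses\<close>

lemma nonzero_if_coeff2: "coeff2 h i j \<noteq> 0 \<Longrightarrow> h \<noteq> 0"
  by (auto simp: coeff2_def)

lemma const2_one: "const2 1 = 1"
  using ring_map.one[OF ring_map_const2] .

lemma const2_zero: "const2 0 = 0"
  using ring_map.zero[OF ring_map_const2] .

lemma const2_minus: "const2 (- c) = - const2 c"
  by (simp add: const2_def)

lemma coeff2_X2: "coeff2 X2 i j = (if i = 1 \<and> j = 0 then 1 else 0)"
  by (auto simp: coeff2_def X2_def coeff_pCons split: nat.splits)

lemma coeff2_Y2: "coeff2 Y2 i j = (if i = 0 \<and> j = 1 then 1 else 0)"
  by (auto simp: coeff2_def Y2_def coeff_pCons one_pCons split: nat.splits)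

lemma coeff2_X2_power: "coeff2 (X2 ^ a) i j = (if i = a \<and> j = 0 then 1 else 0)"
proof -
  have "X2 ^ a = [:monom 1 a:]"
  proof (induction a)
    case (Suc a)
    then show ?case by (simp add: X2_def monom_Suc)
  qed (simp add: one_pCons monom_0)
  then show ?thesis by (auto simp: coeff2_def coeff_pCons split: nat.splits)
qed

lemma wdeg_X2: "wdeg (w1, w2) X2 = w1"
proof (rule antisym)
  show "wdeg (w1, w2) X2 \<le> w1"
    by (rule wdeg_le[OF nonzero_if_coeff2[of _ 1 0]]) (auto simp: coeff2_X2 split: if_splits)
  show "w1 \<le> wdeg (w1, w2) X2"
    using wdeg_ge[of X2 1 0 "(w1, w2)"] by (simp add: coeff2_X2)
qed

lemma wdeg_Y2: "wdeg (w1, w2) Y2 = w2"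
proof (rule antisym)
  show "wdeg (w1, w2) Y2 \<le> w2"
    by (rule wdeg_le[OF nonzero_if_coeff2[of _ 0 1]]) (auto simp: coeff2_Y2 split: if_splits)
  show "w2 \<le> wdeg (w1, w2) Y2"
    using wdeg_ge[of Y2 0 1 "(w1, w2)"] by (simp add: coeff2_Y2)
qed

definition comp2 :: "bipoly \<times> bipoly \<Rightarrow> bipoly \<times> bipoly \<Rightarrow> bipoly \<times> bipoly" where
  "comp2 E F = (subst const2 (fst F) (snd F) (fst E), subst const2 (fst F) (snd F) (snd E))"

lemma poly_map_comp2: "poly_map (comp2 E F) = poly_map E \<circ> poly_map F"
  by (simp add: fun_eq_iff poly_map_def comp2_def eval2_subst)

lemma Aut_C2_comp2:
  assumes "E \<in> Aut_C2" "F \<in> Aut_C2"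
  shows "comp2 E F \<in> Aut_C2"
proof -
  obtain E' F' where E': "poly_map E' \<circ> poly_map E = id" "poly_map E \<circ> poly_map E' = id"
    and F': "poly_map F' \<circ> poly_map F = id" "poly_map F \<circ> poly_map F' = id"
    using assms unfolding Aut_C2_def by blast
  have "poly_map (comp2 F' E') \<circ> poly_map (comp2 E F) = id"
    "poly_map (comp2 E F) \<circ> poly_map (comp2 F' E') = id"
    unfolding poly_map_comp2 using E' F' by (metis comp_assoc comp_id)+
  then show ?thesis unfolding Aut_C2_def by blast
qed

lemma Aut_C2_id: "(X2, Y2) \<in> Aut_C2"
proof -
  have "poly_map (X2, Y2) = id" by (simp add: fun_eq_iff poly_map_def)
  then show ?thesis unfolding Aut_C2_def by force
qed

lemma Aut_C2_exchange: "(Y2, X2) \<in> Aut_C2"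
proof -
  have "poly_map (Y2, X2) \<circ> poly_map (Y2, X2) = id" by (simp add: fun_eq_iff poly_map_def)
  then show ?thesis unfolding Aut_C2_def by blast
qed

lemma Aut_C2_shear: "(X2, Y2 + const2 c * X2 ^ r) \<in> Aut_C2"
proof -
  have "poly_map (X2, Y2 + const2 c * X2 ^ r) \<circ> poly_map (X2, Y2 + const2 (- c) * X2 ^ r) = id" for c
    by (simp add: fun_eq_iff poly_map_def eval2_simps)
  from this[of c] this[of "- c"] show ?thesis unfolding Aut_C2_def by force
qed

lemma subst_X2: "subst const2 f g X2 = f" and subst_Y2: "subst const2 f g Y2 = g"
  by (rule bipoly_eqI; simp add: eval2_subst)+

lemma Aut_C2_swap: "(f, g) \<in> Aut_C2 \<Longrightarrow> (g, f) \<in> Aut_C2"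
  using Aut_C2_comp2[OF Aut_C2_exchange, of "(f, g)"] by (simp add: comp2_def subst_X2 subst_Y2)

lemma Aut_C2_add_power:
  assumes "(f, g) \<in> Aut_C2"
  shows "(f, g + const2 c * f ^ r) \<in> Aut_C2"
proof -
  have "subst const2 f g (Y2 + const2 c * X2 ^ r) = g + const2 c * f ^ r"
    by (rule bipoly_eqI) (simp add: eval2_subst eval2_simps)
  then show ?thesis
    using Aut_C2_comp2[OF Aut_C2_shear assms, of c r] by (simp add: comp2_def subst_X2)
qed

text \<open>
  The inverse in algebraic form: \<open>x\<close> and \<open>y\<close> are polynomials in \<open>f\<close> and \<open>g\<close>.
\<close>
lemma Aut_C2_inverse:
  assumes "(f, g) \<in> Aut_C2"
  obtains P Q where "(P, Q) \<in> Aut_C2" "subst const2 f g P = X2" "subst const2 f g Q = Y2"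
proof -
  obtain G where G: "poly_map G \<circ> poly_map (f, g) = id" "poly_map (f, g) \<circ> poly_map G = id"
    using assms unfolding Aut_C2_def by blast
  have "poly_map (comp2 G (f, g)) = poly_map (X2, Y2)"
    unfolding poly_map_comp2 G by (simp add: fun_eq_iff poly_map_def)
  then have "comp2 G (f, g) = (X2, Y2)" by (simp only: poly_map_inject)
  moreover have "(fst G, snd G) \<in> Aut_C2" using G unfolding Aut_C2_def by auto
  ultimately show ?thesis using that[of "fst G" "snd G"] by (simp add: comp2_def)
qed

text \<open>
  By the chain rule, the Jacobian matrix of the inverse at \<open>(f, g)\<close> times the Jacobian matrix of
  \<open>(f, g)\<close> is the identity matrix.
\<close>
lemma jacobian_unit:
  assumes "(f, g) \<in> Aut_C2"
  shows "jacobian f g dvd 1"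
proof -
  obtain P Q where X: "subst const2 f g P = X2" and Y: "subst const2 f g Q = Y2"
    using Aut_C2_inverse[OF assms] by metis
  let ?a = "subst const2 f g (dx P)" and ?b = "subst const2 f g (pderiv P)"
  let ?c = "subst const2 f g (dx Q)" and ?d = "subst const2 f g (pderiv Q)"
  have "dx X2 = 1" "pderiv X2 = 0" "dx Y2 = 0" "pderiv Y2 = 1"
    by (simp_all add: dx_def X2_def Y2_def map_poly_pCons pderiv_pCons one_pCons)
  then have "?a * dx f + ?b * dx g = 1" "?a * pderiv f + ?b * pderiv g = 0"
    "?c * dx f + ?d * dx g = 0" "?c * pderiv f + ?d * pderiv g = 1"
    using dx_subst[of f g P] pderiv_subst[of f g P] dx_subst[of f g Q] pderiv_subst[of f g Q] X Y
    by simp_all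
  then have "jacobian f g * (?a * ?d - ?b * ?c) = 1"
    unfolding jacobian_def by algebra
  then show ?thesis by (metis dvd_triv_left)
qed

lemma jacobian_nonzero: "(f, g) \<in> Aut_C2 \<Longrightarrow> jacobian f g \<noteq> 0"
  using jacobian_unit by fastforce

text \<open>
  A nonzero Jacobian forces each component to depend on some variable, and each variable to
  occur in some component.
\<close>
lemma wdeg_lower_bounds:
  assumes "jacobian f g \<noteq> 0"
  shows "min w1 w2 \<le> wdeg (w1, w2) f" "min w1 w2 \<le> wdeg (w1, w2) g"
    "max w1 w2 \<le> max (wdeg (w1, w2) f) (wdeg (w1, w2) g)"
proof -
  have "dx f \<noteq> 0 \<or> pderiv f \<noteq> 0" "dx g \<noteq> 0 \<or> pderiv g \<noteq> 0"
    "dx f \<noteq> 0 \<or> dx g \<noteq> 0" "pderiv f \<noteq> 0 \<or> pderiv g \<noteq> 0"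
    using assms by (auto simp: jacobian_def)
  then show "min w1 w2 \<le> wdeg (w1, w2) f" "min w1 w2 \<le> wdeg (w1, w2) g"
    "max w1 w2 \<le> max (wdeg (w1, w2) f) (wdeg (w1, w2) g)"
    using wdeg_dx[of f w1 w2] wdeg_dx[of g w1 w2] wdeg_pderiv[of f w1 w2] wdeg_pderiv[of g w1 w2]
    by linarith+
qed

text \<open>
  If the polynomials that express \<open>x\<close> and \<open>y\<close> in terms of \<open>f\<close> and \<open>g\<close> suffer no cancellation,
  their degrees for the weight \<open>(m, n)\<close> are at most \<open>w1\<close> and \<open>w2\<close>. The bounds of
  \<open>wdeg_lower_bounds\<close> for the automorphism and for its inverse then face each other and
  become equalities.
\<close>
lemma wdeg_eq_weights:
  assumes aut: "(f, g) \<in> Aut_C2" and w: "w1 > 0" "w2 > 0"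
    and m: "m = wdeg (w1, w2) f" and n: "n = wdeg (w1, w2) g"
    and free: "\<And>P. P \<noteq> 0 \<Longrightarrow> wdeg (w1, w2) (subst const2 f g P) < w1 + w2 \<Longrightarrow>
      wdeg (m, n) P \<le> wdeg (w1, w2) (subst const2 f g P)"
  shows "(m, n) \<in> {(w1, w2), (w2, w1)}"
proof -
  obtain P Q where PQ: "(P, Q) \<in> Aut_C2" "subst const2 f g P = X2" "subst const2 f g Q = Y2"
    using Aut_C2_inverse[OF aut] by metis
  have "wdeg (m, n) P \<le> w1" "wdeg (m, n) Q \<le> w2"
    using free[of P] free[of Q] Aut_C2_nonzero[OF PQ(1)] PQ(2,3) w by (simp_all add: wdeg_X2 wdeg_Y2)
  then have "min m n \<le> min w1 w2" "max m n \<le> max w1 w2"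
    using wdeg_lower_bounds[OF jacobian_nonzero[OF PQ(1)], of m n] by linarith+
  moreover have "min w1 w2 \<le> min m n" "max w1 w2 \<le> max m n"
    using wdeg_lower_bounds[OF jacobian_nonzero[OF aut], of w1 w2] m n by simp_all
  ultimately show ?thesis by (auto simp: min_def max_def split: if_splits)
qed

section \<open>Constraints on the bidegree\<close>

lemma add_le_lcm:
  fixes m n :: nat
  assumes "\<not> m dvd n" "\<not> n dvd m" "m > 0" "n > 0"
  shows "m + n \<le> lcm m n"
proof -
  have "2 * a \<le> lcm m n" if a: "a dvd lcm m n" "a \<noteq> lcm m n" for a
  proof -
    obtain k where k: "lcm m n = a * k" using a(1) by blast
    have "lcm m n > 0" using assms by (simp add: lcm_pos_nat)
    then have "k \<noteq> 0" "k \<noteq> 1" using k a(2) by auto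
    then have "2 \<le> k" by linarith
    then show ?thesis unfolding k by simp
  qed
  moreover have "m \<noteq> lcm m n" "n \<noteq> lcm m n"
    using assms by (metis dvd_lcm1 dvd_lcm2)+
  ultimately have "2 * m \<le> lcm m n" "2 * n \<le> lcm m n" by simp_all
  then show ?thesis by linarith
qed

lemma wdeg_positive:
  assumes "(f, g) \<in> Aut_C2" "w1 > 0" "w2 > 0"
  shows "wdeg (w1, w2) f > 0" "wdeg (w1, w2) g > 0"
  using wdeg_lower_bounds[OF jacobian_nonzero[OF assms(1)], of w1 w2] assms by linarith+

text \<open>
  If neither degree divides the other, then \<open>m + n \<le> lcm m n\<close>. In \<open>wdeg_subst_lower_bound\<close> a
  positive \<open>k\<close> would then give a degree of at least \<open>w1 + w2\<close>, whereas \<open>x\<close> and \<open>y\<close> have degrees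
  \<open>w1\<close> and \<open>w2\<close>. So there is no cancellation.
\<close>
lemma wdeg_dvd_or_weights:
  assumes aut: "(f, g) \<in> Aut_C2" and w: "w1 > 0" "w2 > 0"
    and m: "m = wdeg (w1, w2) f" and n: "n = wdeg (w1, w2) g"
    and ndvd: "\<not> m dvd n" "\<not> n dvd m"
  shows "(m, n) \<in> {(w1, w2), (w2, w1)}"
proof (rule wdeg_eq_weights[OF aut w m n])
  fix P assume P: "P \<noteq> 0" and small: "wdeg (w1, w2) (subst const2 f g P) < w1 + w2"
  have pos: "m > 0" "n > 0" using wdeg_positive[OF aut w] m n by simp_all
  obtain k where k: "k * lcm m n \<le> wdeg (m, n) P"
    "wdeg (m, n) P + k * (w1 + w2) \<le> wdeg (w1, w2) (subst const2 f g P) + k * (m + n)"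
    using wdeg_subst_lower_bound[OF jacobian_nonzero[OF aut] Aut_C2_nonzero[OF aut] m pos(1) n pos(2) P]
    by blast
  have "k * (m + n) \<le> k * lcm m n" using add_le_lcm[OF ndvd pos] by simp
  then have *: "k * (w1 + w2) < w1 + w2" using k small by linarith
  have "k = 0"
  proof (rule ccontr)
    assume "k \<noteq> 0"
    then have "1 * (w1 + w2) \<le> k * (w1 + w2)" by (intro mult_le_mono1) simp
    then show False using * by simp
  qed
  then show "wdeg (m, n) P \<le> wdeg (w1, w2) (subst const2 f g P)" using k(2) by simp
qed

lemma eval2_sum: "eval2 P (a, b) = (\<Sum>(i, j)\<in>supp2 P. coeff2 P i j * a ^ i * b ^ j)"
  by (simp add: eval2_eq_subst subst_sum[OF ring_map_ident])

text \<open>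
  For the weight \<open>(m, m r)\<close> a form is, up to a power of \<open>x\<close>, a homogeneous polynomial in \<open>x\<^sup>r\<close> and
  \<open>y\<close>, hence a product of factors \<open>y - z x\<^sup>r\<close> and \<open>x\<^sup>r\<close>. The \<open>z\<close> are
  the roots of its restriction to \<open>x = 1\<close>: wherever \<open>u\<close> does not vanish, \<open>v / u\<^sup>r\<close> is one of the finitely
  many roots \<open>z\<close>, so the product of \<open>u\<close> and all \<open>v - z u\<^sup>r\<close> vanishes everywhere.
\<close>
lemma wpart_relation_imp_power:
  assumes m: "m > 0" and u: "u \<noteq> 0"
    and P: "wpart (m, m * r) d P \<noteq> 0"
    and rel: "subst const2 u v (wpart (m, m * r) d P) = 0"
  shows "\<exists>c. v = const2 c * u ^ r"
proof -
  let ?H = "wpart (m, m * r) d P"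
  let ?\<phi> = "map_poly (\<lambda>p. poly p 1) ?H"
  have supp: "(i + r * j) * m = d" if "(i, j) \<in> supp2 ?H" for i j
    using that by (auto simp: supp2_def coeff2_wpart algebra_simps split: if_splits)
  \<comment> \<open>The form is quasi-homogeneous, so its values are determined by those on \<open>x = 1\<close>.\<close>
  have hom: "eval2 ?H (\<alpha>, \<beta>) = \<alpha> ^ (d div m) * poly ?\<phi> (\<beta> / \<alpha> ^ r)" if "\<alpha> \<noteq> 0" for \<alpha> \<beta>
  proof -
    have "coeff2 ?H i j * \<alpha> ^ i * \<beta> ^ j = \<alpha> ^ (d div m) * (coeff2 ?H i j * 1 ^ i * (\<beta> / \<alpha> ^ r) ^ j)"
      if "(i, j) \<in> supp2 ?H" for i j
    proof -
      have "d div m = i + r * j" using supp[OF that] m by auto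
      then show ?thesis using \<open>\<alpha> \<noteq> 0\<close>
        by (simp add: power_add power_mult power_divide)
    qed
    then show ?thesis
      unfolding eval2_eq_poly[symmetric] eval2_sum sum_distrib_left
      by (intro sum.cong) auto
  qed
  have "?\<phi> \<noteq> 0"
  proof -
    obtain j where "coeff ?H j \<noteq> 0" using P by (auto simp: poly_eq_iff)
    then have "coeff ?\<phi> j \<noteq> 0" using wpart_slice_coeff[OF m, of 1] by simp
    then show ?thesis by auto
  qed
  let ?Z = "{z. poly ?\<phi> z = 0}"
  have fin: "finite ?Z" using poly_roots_finite[OF \<open>?\<phi> \<noteq> 0\<close>] .
  have "eval2 (u * (\<Prod>z\<in>?Z. v - const2 z * u ^ r)) p = 0" for p
  proof (cases "eval2 u p = 0")
    case False
    let ?z = "eval2 v p / eval2 u p ^ r"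
    have "eval2 ?H (eval2 u p, eval2 v p) = 0"
      using rel eval2_subst[of u v ?H p] by (simp add: eval2_simps)
    then have root: "?z \<in> ?Z" using hom[OF False] False by simp
    have "(\<Prod>z\<in>?Z. v - const2 z * u ^ r) = (v - const2 ?z * u ^ r) * (\<Prod>z\<in>?Z - {?z}. v - const2 z * u ^ r)"
      using fin root by (rule prod.remove)
    moreover have "eval2 (v - const2 ?z * u ^ r) p = 0"
      using False by (simp add: eval2_simps)
    ultimately show ?thesis by (simp add: eval2_simps)
  qed (simp add: eval2_simps)
  then have "u * (\<Prod>z\<in>?Z. v - const2 z * u ^ r) = 0"
    by (intro bipoly_eqI) (simp add: eval2_simps)
  then have "\<exists>z\<in>?Z. v - const2 z * u ^ r = 0" using u fin by simp
  then show ?thesis by auto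
qed

text \<open>
  Let \<open>wdeg g = r * wdeg f\<close>. If the leading forms satisfy a relation, that of \<open>g\<close> is
  \<open>c\<close> times the \<open>r\<close>-th power of that of \<open>f\<close>, and \<open>g - c f\<^sup>r\<close> has smaller degree. This step
  leaves \<open>f\<close> unchanged, and the degree of \<open>g\<close> is a multiple of that of \<open>f\<close>, so the property
  passes back from the smaller automorphism. Without a relation nothing cancels and the degrees
  are the weights.
\<close>
lemma wdeg_multiple_of_weight:
  assumes "(f, g) \<in> Aut_C2" and w: "w1 > 0" "w2 > 0"
  shows "(w1 dvd wdeg (w1, w2) f \<or> w2 dvd wdeg (w1, w2) f) \<and>
    (w1 dvd wdeg (w1, w2) g \<or> w2 dvd wdeg (w1, w2) g)"
  using assms(1)
proof (induction "wdeg (w1, w2) f + wdeg (w1, w2) g" arbitrary: f g rule: less_induct)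
  case less
  let ?d = "wdeg (w1, w2)" and ?top = "topform (w1, w2)"
  have IH: "(w1 dvd ?d f' \<or> w2 dvd ?d f') \<and> (w1 dvd ?d g' \<or> w2 dvd ?d g')"
    if "(f', g') \<in> Aut_C2" "?d f' + ?d g' < ?d f + ?d g" for f' g'
    using less.hyps[OF that(2,1)] .
  have step: "(w1 dvd ?d f' \<or> w2 dvd ?d f') \<and> (w1 dvd ?d g' \<or> w2 dvd ?d g')"
    if aut: "(f', g') \<in> Aut_C2" and eq: "?d f' + ?d g' = ?d f + ?d g" and dvd: "?d f' dvd ?d g'" for f' g'
  proof -
    obtain r where r: "?d g' = ?d f' * r" using dvd by blast
    have pos: "?d f' > 0" "?d g' > 0" using wdeg_positive[OF aut w] .
    note nz = Aut_C2_nonzero[OF aut]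
    show ?thesis
    proof (cases "\<exists>c. ?top g' = const2 c * ?top f' ^ r")
      case True
      then obtain c where c: "?top g' = const2 c * ?top f' ^ r" by blast
      define h where "h = g' + const2 (- c) * f' ^ r"
      have aut': "(f', h) \<in> Aut_C2" unfolding h_def by (rule Aut_C2_add_power[OF aut])
      have hom: "homog (w1, w2) h = homog (w1, w2) g' + tconst (- c) * homog (w1, w2) f' ^ r"
        unfolding h_def using ring_map_homog[of "(w1, w2)"]
        by (simp only: ring_map.add ring_map.mult ring_map.power homog_const2)
      have degf: "degree (homog (w1, w2) f') = ?d f'" and degg: "degree (homog (w1, w2) g') = ?d f' * r"
        using nz by (simp_all add: degree_homog r)
      have pw: "degree (homog (w1, w2) f' ^ r) \<le> ?d f' * r"
        "coeff (homog (w1, w2) f' ^ r) (?d f' * r) = ?top f' ^ r"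
        using coeff_power_top[of "homog (w1, w2) f'" "?d f'" r] degf by (simp_all add: mult.commute topform_def)
      \<comment> \<open>Both summands have degree at most \<open>wdeg g'\<close>, and their coefficients there cancel.\<close>
      have "degree (homog (w1, w2) h) \<le> ?d f' * r"
        unfolding hom using pw(1) degg
        by (intro degree_add_le order.trans[OF degree_mult_le]) simp_all
      moreover have "coeff (homog (w1, w2) h) (?d f' * r) = 0"
        unfolding hom using c degg pw(2) by (simp add: topform_def const2_minus)
      ultimately have "degree (homog (w1, w2) h) < ?d f' * r"
        using pos r by (metis degree_0 le_neq_implies_less leading_coeff_0_iff)
      then have "?d h < ?d g'" using Aut_C2_nonzero[OF aut'] r by (simp add: degree_homog)
      then have "w1 dvd ?d f' \<or> w2 dvd ?d f'" using IH[OF aut'] eq by simp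
      then show ?thesis using r by auto
    next
      case False
      have "(?d f', ?d g') \<in> {(w1, w2), (w2, w1)}"
      proof (rule wdeg_eq_weights[OF aut w refl refl])
        fix P :: bipoly assume "P \<noteq> 0"
        let ?W = "wdeg (?d f', ?d g') P"
        have "subst const2 (?top f') (?top g') (wpart (?d f', ?d g') ?W P) \<noteq> 0"
          using wpart_relation_imp_power[OF pos(1) topform_nonzero[OF nz(1)], of r ?W P] False
            wpart_wdeg_nonzero[OF \<open>P \<noteq> 0\<close>] r by metis
        then show "?W \<le> ?d (subst const2 f' g' P)"
          using wdeg_ge[of P] by (intro wdeg_subst_ge(2)[OF nz refl refl]) auto
      qed
      then show ?thesis by auto
    qed
  qed
  consider "?d f dvd ?d g" | "?d g dvd ?d f" | "(?d f, ?d g) \<in> {(w1, w2), (w2, w1)}"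
    using wdeg_dvd_or_weights[OF less.prems w refl refl] by blast
  then show ?case
  proof cases
    case 1
    then show ?thesis using step[OF less.prems] by simp
  next
    case 2
    then show ?thesis using step[OF Aut_C2_swap[OF less.prems]] by simp
  qed auto
qed

text \<open>
  Exchanging \<open>x\<close> and \<open>y\<close> exchanges the two weights, which reduces the remaining arguments to one
  order of the weights.
\<close>
definition swap_vars :: "bipoly \<Rightarrow> bipoly" where "swap_vars h = subst const2 Y2 X2 h"

lemma swap_vars_swap_vars: "swap_vars (swap_vars h) = h"
  by (rule bipoly_eqI) (simp add: swap_vars_def eval2_subst)

lemma Aut_C2_swap_vars: "(f, g) \<in> Aut_C2 \<Longrightarrow> (swap_vars f, swap_vars g) \<in> Aut_C2"
  using Aut_C2_comp2[OF _ Aut_C2_exchange, of "(f, g)"] by (simp add: comp2_def swap_vars_def)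

lemma wdeg_swap_vars:
  assumes "h \<noteq> 0" shows "wdeg (w1, w2) (swap_vars h) = wdeg (w2, w1) h"
proof -
  have le: "wdeg (w1, w2) (swap_vars h) \<le> wdeg (w2, w1) h" if "h \<noteq> 0" for h w1 w2
  proof -
    have "swap_vars h \<noteq> 0"
    proof
      assume "swap_vars h = 0"
      then have "swap_vars (swap_vars h) = 0" by (simp add: swap_vars_def subst_def)
      then show False using that by (simp add: swap_vars_swap_vars)
    qed
    have "homog (w1, w2) X2 = monom X2 w1" "homog (w1, w2) Y2 = monom Y2 w2"
      by (simp_all add: homog_def subst_def X2_def Y2_def map_poly_pCons const2_zero const2_one)
    then have "homog (w1, w2) (swap_vars h) = subst tconst (monom Y2 w2) (monom X2 w1) h"
      by (simp add: swap_vars_def homog_subst)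
    then have "degree (homog (w1, w2) (swap_vars h)) \<le> wdeg (w2, w1) h"
      using wdeg_ge[of h _ _ "(w2, w1)"] by (simp add: subst_top(1)[OF degree_monom_le degree_monom_le])
    then show ?thesis using \<open>swap_vars h \<noteq> 0\<close> by (simp add: degree_homog)
  qed
  have "swap_vars h \<noteq> 0"
    using assms swap_vars_swap_vars[of h] by (auto simp: swap_vars_def subst_def)
  then show ?thesis using le[OF assms, of w1 w2] le[of "swap_vars h" w2 w1] by (simp add: swap_vars_swap_vars)
qed

text \<open>
  A component of degree less than \<open>w2\<close> does not involve \<open>y\<close>. Its derivative in \<open>x\<close> then divides
  the Jacobian, which is a unit, so the component is \<open>c x + b\<close> with \<open>c \<noteq> 0\<close>.
\<close>
lemma wdeg_small_component:
  assumes aut: "(f, g) \<in> Aut_C2" and "w1 \<le> w2" and small: "wdeg (w1, w2) f < w2"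
  shows "wdeg (w1, w2) f = w1"
proof -
  have f: "f \<noteq> 0" using Aut_C2_nonzero[OF aut] by simp
  have dy: "pderiv f = 0" using wdeg_pderiv[of f w1 w2] small by linarith
  have "dx f dvd 1"
    using jacobian_unit[OF aut] dy by (auto simp: jacobian_def dest: dvd_mult_left)
  then obtain c where c: "dx f = const2 c" "c \<noteq> 0"
    by (fastforce simp: is_unit_poly_iff const2_def)
  have "coeff2 f i (Suc j) = 0" for i j
  proof -
    have "coeff2 (pderiv f) i j = 0" by (simp add: dy coeff2_def)
    then show ?thesis by (simp add: coeff2_pderiv del: of_nat_Suc)
  qed
  then have y: "j = 0" if "coeff2 f i j \<noteq> 0" for i j using that by (cases j) auto
  have x: "of_nat (Suc i) * coeff2 f (Suc i) 0 = (if i = 0 then c else 0)" for i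
    using coeff2_dx[of f i 0, symmetric] by (simp add: c coeff2_def const2_def coeff_pCons split: nat.splits)
  have "i \<le> 1" if "coeff2 f i j \<noteq> 0" for i j
  proof (rule ccontr)
    assume "\<not> i \<le> 1"
    then obtain i' where "i = Suc i'" "i' \<noteq> 0" by (cases i) auto
    then show False using x[of i'] that y[OF that] by (simp del: of_nat_Suc)
  qed
  then have "wdeg (w1, w2) f \<le> w1"
    using y by (intro wdeg_le[OF f]) fastforce
  moreover have "coeff2 f 1 0 \<noteq> 0" using x[of 0] c(2) by auto
  then have "w1 \<le> wdeg (w1, w2) f" using wdeg_ge[of f 1 0 "(w1, w2)"] by simp
  ultimately show ?thesis by simp
qed

lemma wdeg_small_component_min:
  assumes aut: "(f, g) \<in> Aut_C2" and small: "wdeg (w1, w2) f < max w1 w2"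
  shows "wdeg (w1, w2) f = min w1 w2"
proof (cases "w1 \<le> w2")
  case True
  then show ?thesis using wdeg_small_component[OF aut True] small by simp
next
  case False
  have eq: "wdeg (w2, w1) (swap_vars f) = wdeg (w1, w2) f"
    using Aut_C2_nonzero[OF aut] by (simp add: wdeg_swap_vars)
  then show ?thesis
    using wdeg_small_component[OF Aut_C2_swap_vars[OF aut], of w2 w1] False small by simp
qed

lemma bidegree_in_A_set:
  assumes aut: "(f, g) \<in> Aut_C2" and w: "w1 > 0" "w2 > 0"
  shows "(wdeg (w1, w2) f, wdeg (w1, w2) g) \<in>
    A_set (w1, w2) w1 \<union> A_set (w1, w2) w2 \<union> {(w1, w2), (w2, w1), (max w1 w2, max w1 w2)}"
proof -
  let ?m = "wdeg (w1, w2) f" and ?n = "wdeg (w1, w2) g"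
  have pos: "?m > 0" "?n > 0" using wdeg_positive[OF aut w] .
  consider "(?m, ?n) \<in> {(w1, w2), (w2, w1)}" | "?m dvd ?n \<or> ?n dvd ?m"
    using wdeg_dvd_or_weights[OF aut w refl refl] by blast
  then show ?thesis
  proof cases
    case 2
    have "max ?m ?n \<ge> max w1 w2"
      using wdeg_lower_bounds(3)[OF jacobian_nonzero[OF aut]] .
    moreover have "min ?m ?n < max w1 w2 \<longrightarrow> min ?m ?n = min w1 w2"
      using wdeg_small_component_min[OF aut, of w1 w2] wdeg_small_component_min[OF Aut_C2_swap[OF aut], of w1 w2]
      by linarith
    moreover have "(w1 dvd ?m \<and> w1 dvd ?n) \<or> (w2 dvd ?m \<and> w2 dvd ?n)"
      using wdeg_multiple_of_weight[OF aut w] 2 by (meson dvd_trans)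
    moreover have "d \<in> {v * k | k. k > 0}" if "v dvd d" "d > 0" for v d :: nat
      using that by (auto elim!: dvdE)
    ultimately show ?thesis using 2 pos by (auto simp: A_set_def)
  qed blast
qed

section \<open>Automorphisms of prescribed bidegree\<close>

definition attained :: "nat \<times> nat \<Rightarrow> nat \<times> nat \<Rightarrow> bool" where
  "attained w d \<longleftrightarrow> (\<exists>f g. (f, g) \<in> Aut_C2 \<and> d = (wdeg w f, wdeg w g))"

lemma attainedI: "(f, g) \<in> Aut_C2 \<Longrightarrow> attained w (wdeg w f, wdeg w g)"
  by (auto simp: attained_def)

lemma attained_swap: "attained w (d1, d2) \<Longrightarrow> attained w (d2, d1)"
  using Aut_C2_swap by (auto simp: attained_def)

lemma attained_swap_weights: "attained (w1, w2) d \<Longrightarrow> attained (w2, w1) d"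
proof -
  assume "attained (w1, w2) d"
  then obtain f g where fg: "(f, g) \<in> Aut_C2" "d = (wdeg (w1, w2) f, wdeg (w1, w2) g)"
    by (auto simp: attained_def)
  then have "d = (wdeg (w2, w1) (swap_vars f), wdeg (w2, w1) (swap_vars g))"
    using Aut_C2_nonzero[OF fg(1)] by (simp add: wdeg_swap_vars)
  then show ?thesis using Aut_C2_swap_vars[OF fg(1)] by (auto simp: attained_def)
qed

lemma wdeg_shear:
  assumes "w2 \<le> a * w1" "a > 0"
  shows "wdeg (w1, w2) (Y2 + X2 ^ a) = a * w1"
proof (rule antisym)
  have c: "coeff2 (Y2 + X2 ^ a) i j = coeff2 Y2 i j + coeff2 (X2 ^ a) i j" for i j
    by (simp add: coeff2_def)
  have nz: "coeff2 (Y2 + X2 ^ a) a 0 \<noteq> 0"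
    using \<open>a > 0\<close> by (simp add: c coeff2_Y2 coeff2_X2_power)
  then show "a * w1 \<le> wdeg (w1, w2) (Y2 + X2 ^ a)" using wdeg_ge[OF nz, of "(w1, w2)"] by simp
  have "Y2 + X2 ^ a \<noteq> 0" using nz by (rule nonzero_if_coeff2)
  then show "wdeg (w1, w2) (Y2 + X2 ^ a) \<le> a * w1"
    using assms by (intro wdeg_le) (auto simp: c coeff2_Y2 coeff2_X2_power split: if_splits)
qed

text \<open>
  The power \<open>x\<^bsup>a r\<^esup>\<close> occurs with coefficient \<open>1\<close> in the \<open>r\<close>-th power, and with coefficient \<open>2\<close> in
  the sum if \<open>a = r = 1\<close>; in no case does it cancel against the summand \<open>x\<close>.
\<close>
lemma wdeg_double_shear:
  assumes "w2 \<le> a * w1" "a > 0" "r > 0"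
  shows "wdeg (w1, w2) (X2 + (Y2 + X2 ^ a) ^ r) = a * r * w1"
proof (rule antisym)
  let ?u = "Y2 + X2 ^ a"
  have c: "coeff2 (X2 + ?u ^ r) i j = coeff2 X2 i j + coeff2 (?u ^ r) i j" for i j
    by (simp add: coeff2_def)
  have "coeff (?u ^ r) 0 = coeff ((X2 ^ a) ^ r) 0"
    by (simp add: coeff_0_power Y2_def)
  then have "coeff2 (?u ^ r) (a * r) 0 = 1"
    using coeff2_X2_power[of "a * r" "a * r" 0] by (simp add: coeff2_def power_mult)
  then have nz: "coeff2 (X2 + ?u ^ r) (a * r) 0 \<noteq> 0" by (simp add: c coeff2_X2)
  then show "a * r * w1 \<le> wdeg (w1, w2) (X2 + ?u ^ r)" using wdeg_ge[OF nz, of "(w1, w2)"] by simp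
  have "coeff2 ?u a 0 = 1"
    using assms(2) by (simp add: coeff2_def) (simp add: coeff2_def[symmetric] coeff2_Y2 coeff2_X2_power)
  then have u: "?u \<noteq> 0" by (intro nonzero_if_coeff2[of _ a 0]) simp
  have "wdeg (w1, w2) (?u ^ k) \<le> k * (a * w1)" for k
  proof (induction k)
    case 0
    show ?case by (rule wdeg_le) (auto simp: coeff2_def coeff_pCons one_pCons split: nat.splits)
  next
    case (Suc k)
    then show ?case using u by (simp add: wdeg_mult wdeg_shear[OF assms(1,2)])
  qed
  then have pw: "i * w1 + j * w2 \<le> r * (a * w1)" if "coeff2 (?u ^ r) i j \<noteq> 0" for i j
    using wdeg_ge[OF that, of "(w1, w2)"] by (metis fst_conv snd_conv le_trans)
  have "1 \<le> r * a" using assms by simp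
  then have "1 * w1 \<le> (r * a) * w1" by (rule mult_le_mono1)
  then have X: "w1 \<le> r * (a * w1)" by (simp add: mult.assoc)
  have "X2 + ?u ^ r \<noteq> 0" using nz by (rule nonzero_if_coeff2)
  then show "wdeg (w1, w2) (X2 + ?u ^ r) \<le> a * r * w1"
  proof (rule wdeg_le)
    fix i j assume "coeff2 (X2 + ?u ^ r) i j \<noteq> 0"
    then consider "i = 1" "j = 0" | "coeff2 (?u ^ r) i j \<noteq> 0"
      by (auto simp: c coeff2_X2 split: if_splits)
    then show "i * fst (w1, w2) + j * snd (w1, w2) \<le> a * r * w1"
      using X pw by cases (auto simp: mult.assoc mult.left_commute)
  qed
qed

lemma Aut_C2_shears:
  shows "(X2, Y2 + X2 ^ a) \<in> Aut_C2" "(Y2 + X2 ^ a, X2 + (Y2 + X2 ^ a) ^ r) \<in> Aut_C2"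
proof -
  show 1: "(X2, Y2 + X2 ^ a) \<in> Aut_C2"
    using Aut_C2_add_power[OF Aut_C2_id, of 1 a] by (simp add: const2_one)
  show "(Y2 + X2 ^ a, X2 + (Y2 + X2 ^ a) ^ r) \<in> Aut_C2"
    using Aut_C2_add_power[OF Aut_C2_swap[OF 1], of 1 r] by (simp add: const2_one)
qed

text \<open>
  If \<open>d1 = a w1 \<ge> w2\<close>, the component \<open>y + x\<^sup>a\<close> has degree \<open>d1\<close>, and adding its \<open>r\<close>-th power to
  \<open>x\<close> gives a component of degree \<open>r d1\<close>. If \<open>d1 < w2\<close>, the last condition on \<open>A_set\<close> leaves only
  \<open>d1 = w1\<close>, for which the shear \<open>(x, y + x\<^sup>b)\<close> suffices.
\<close>
lemma A_set_attained_ordered: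
  assumes w: "w1 > 0" "w2 > 0" and d: "(d1, d2) \<in> A_set (w1, w2) w1" and le: "d1 \<le> d2"
  shows "attained (w1, w2) (d1, d2)"
proof -
  obtain a b where a: "d1 = w1 * a" "a > 0" and b: "d2 = w1 * b" "b > 0"
    using d by (auto simp: A_set_def)
  have big: "max w1 w2 \<le> d2" and small: "d1 < max w1 w2 \<longrightarrow> d1 = min w1 w2" and dvd: "d1 dvd d2"
    using d le a b by (auto simp: A_set_def min_absorb1 max_absorb2 dest: dvd_imp_le)
  show ?thesis
  proof (cases "w2 \<le> d1")
    case True
    have "a dvd b" using dvd a b w by simp
    then obtain r where r: "b = a * r" by blast
    then have "r > 0" using b by simp
    then show ?thesis
      using attainedI[OF Aut_C2_shears(2)[of a r], of "(w1, w2)"] True a b r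
      by (simp add: wdeg_shear wdeg_double_shear mult.commute)
  next
    case False
    then have "d1 = min w1 w2" using small by simp
    moreover have "w1 * 1 \<le> w1 * a" using a by (intro mult_le_mono2) simp
    ultimately have "d1 = w1" using a by linarith
    then show ?thesis
      using attainedI[OF Aut_C2_shears(1)[of b], of "(w1, w2)"] b big
      by (simp add: wdeg_shear wdeg_X2 mult.commute)
  qed
qed

lemma A_set_attained:
  assumes "w1 > 0" "w2 > 0" "d \<in> A_set (w1, w2) w1"
  shows "attained (w1, w2) d"
proof (cases d)
  case (Pair d1 d2)
  show ?thesis
  proof (cases "d1 \<le> d2")
    case True
    then show ?thesis using A_set_attained_ordered assms Pair by blast
  next
    case False
    have "(d2, d1) \<in> A_set (w1, w2) w1"
      using assms(3) by (auto simp: Pair A_set_def min.commute max.commute)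
    then show ?thesis
      using A_set_attained_ordered[of w1 w2 d2 d1] assms False attained_swap Pair by simp
  qed
qed

theorem theorem1p1:
  fixes w1 w2 :: nat
  assumes "w1 > 0" and "w2 > 0"
  shows "{(wdeg (w1, w2) F1, wdeg (w1, w2) F2) | F1 F2. (F1, F2) \<in> Aut_C2} =
    A_set (w1, w2) w1 \<union> A_set (w1, w2) w2 \<union>
      {(w1, w2), (w2, w1), (max w1 w2, max w1 w2)}"
proof (intro equalityI subsetI)
  fix d assume "d \<in> {(wdeg (w1, w2) F1, wdeg (w1, w2) F2) | F1 F2. (F1, F2) \<in> Aut_C2}"
  then show "d \<in> A_set (w1, w2) w1 \<union> A_set (w1, w2) w2 \<union> {(w1, w2), (w2, w1), (max w1 w2, max w1 w2)}"
    using bidegree_in_A_set[OF _ assms] by blast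
next
  fix d assume d: "d \<in> A_set (w1, w2) w1 \<union> A_set (w1, w2) w2 \<union> {(w1, w2), (w2, w1), (max w1 w2, max w1 w2)}"
  \<comment> \<open>The automorphism \<open>(x, x + y)\<close>.\<close>
  have diag: "attained (v1, v2) (v1, v1)" if "v2 \<le> v1" for v1 v2
    using attainedI[OF Aut_C2_shears(1)[of 1], of "(v1, v2)"] wdeg_shear[of v2 1 v1] that
    by (simp add: wdeg_X2)
  have "A_set (w1, w2) w2 = A_set (w2, w1) w2"
    by (simp add: A_set_def max.commute min.commute)
  moreover have "attained (w1, w2) (w1, w2)"
    using attainedI[OF Aut_C2_id, of "(w1, w2)"] by (simp add: wdeg_X2 wdeg_Y2)
  moreover have "attained (w1, w2) (max w1 w2, max w1 w2)"
    using diag[of w2 w1] attained_swap_weights[OF diag[of w1 w2]] by (cases "w1 \<le> w2") simp_all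
  ultimately have "attained (w1, w2) d"
    using d A_set_attained[OF assms] attained_swap_weights[OF A_set_attained[OF assms(2,1)]] attained_swap
    by (elim UnE) auto
  then show "d \<in> {(wdeg (w1, w2) F1, wdeg (w1, w2) F2) | F1 F2. (F1, F2) \<in> Aut_C2}"
    by (auto simp: attained_def)
qed

end
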